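(* Let $p$ be a prime. There exists $g\in\mathbb{C}^{\mathbb{Z}_p}\setminus\{0\}$ such that for all $f\in\mathbb{C}^{\mathbb{Z}_p}\setminus\{0\}$ $$\|f\|_0+\|V_gf\|_0\ \geq\ p^2+1 .$$ Moreover (for this $g$), for all integers $k,l$ with $1\le k\le p$, $1\le l\le p^2$ and $k+l\ge p^2+1$ there exists $f\in\mathbb{C}^{\mathbb{Z}_p}$ with $\|f\|_0=k$ and $\|V_gf\|_0=l$.
   Context: For a finite set $A$, $\mathbb{C}^A$ is the space of functions $f:A\to\mathbb{C}$, and $\|f\|_0=|\{a\in A: f(a)\ne 0\}|$ denotes the cardinality of the support of $f$. For a finite Abelian group $G$ with dual group $\widehat G$ (the group of homomorphisms $\xi:G\to\{z\in\mathbb{C}:|z|=1\}$, with $\langle\xi,x\rangle=\xi(x)$), the short-time Fourier transform of $f\in\mathbb{C}^G$ with respect to the window $g\in\mathbb{C}^G\setminus\{0\}$ is the function $V_gf\in\mathbb{C}^{G\times\widehat G}$ given by $V_gf(x,\xi)=\sum_{y\in G}f(y)\,\overline{g(y-x)}\,\overline{\langle\xi,y\rangle}$. Here $G=\mathbb{Z}_p$ is the cyclic group of order $p$. *)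

theory Defs
  imports Complex_Main "HOL-Library.FuncSet" "HOL-Computational_Algebra.Primes"
    "HOL-Algebra.Elementary_Groups"
begin

text \<open>
  Functions on a carrier set are represented by their extensional representatives, which take
  the value \<^term>\<open>undefined\<close> outside the set; two functions on \<open>A\<close> are then equal as elements of
  the function space iff they agree on \<open>A\<close>.
\<close>

definition cfun_space :: "'a set \<Rightarrow> ('a \<Rightarrow> complex) set"
  where "cfun_space A = A \<rightarrow>\<^sub>E (UNIV :: complex set)"

definition cfun_zero :: "'a set \<Rightarrow> 'a \<Rightarrow> complex"
  where "cfun_zero A = (\<lambda>a\<in>A. 0)"

definition norm0 :: "'a set \<Rightarrow> ('a \<Rightarrow> complex) \<Rightarrow> nat"
  where "norm0 A f = card {a \<in> A. f a \<noteq> 0}"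

definition circle_group :: "complex monoid"
  where "circle_group = \<lparr>carrier = {z. cmod z = 1}, monoid.mult = (*), one = 1\<rparr>"

text \<open>
  The set \<^const>\<open>hom\<close> does not constrain values outside the carrier; without the restriction to
  extensional functions each character would be counted once for every such extension.
\<close>

definition dual_group :: "('a, 'm) monoid_scheme \<Rightarrow> ('a \<Rightarrow> complex) monoid"
  where "dual_group G =
    \<lparr>carrier = hom G circle_group \<inter> extensional (carrier G),
     monoid.mult = (\<lambda>\<xi> \<eta>. \<lambda>x\<in>carrier G. \<xi> x * \<eta> x),
     one = (\<lambda>x\<in>carrier G. 1)\<rparr>"

text \<open>The group \<open>G\<close> is written multiplicatively, so \<open>y - x\<close> becomes \<open>y \<otimes> inv x\<close>.\<close>

definition stft ::
    "('a, 'm) monoid_scheme \<Rightarrow> ('a \<Rightarrow> complex) \<Rightarrow> ('a \<Rightarrow> complex) \<Rightarrow> 'a \<times> ('a \<Rightarrow> complex) \<Rightarrow> complex"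
  where "stft G g f =
    (\<lambda>(x, \<xi>)\<in>carrier G \<times> carrier (dual_group G).
       \<Sum>y\<in>carrier G. f y * cnj (g (y \<otimes>\<^bsub>G\<^esub> inv\<^bsub>G\<^esub> x)) * cnj (\<xi> y))"

lemma comm_group_circle_group: "comm_group circle_group"
proof (rule comm_groupI)
  fix z assume z: "z \<in> carrier circle_group"
  then have "z \<noteq> 0"
    by (auto simp: circle_group_def)
  with z have "inverse z \<in> carrier circle_group" "inverse z * z = 1"
    by (simp_all add: circle_group_def norm_inverse)
  then show "\<exists>w\<in>carrier circle_group. w \<otimes>\<^bsub>circle_group\<^esub> z = \<one>\<^bsub>circle_group\<^esub>"
    by (auto simp: circle_group_def)
qed (auto simp: circle_group_def norm_mult)

lemma comm_group_dual_group:
  assumes "comm_group G"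
  shows "comm_group (dual_group G)"
proof -
  interpret comm_group G by fact
  note defs = dual_group_def circle_group_def hom_def
  show ?thesis
  proof (rule comm_groupI)
    fix \<xi> assume \<xi>: "\<xi> \<in> carrier (dual_group G)"
    let ?\<eta> = "\<lambda>x\<in>carrier G. inverse (\<xi> x)"
    have "\<xi> x \<noteq> 0" if "x \<in> carrier G" for x
      using \<xi> that by (force simp: defs)
    with \<xi> have "?\<eta> \<in> carrier (dual_group G)"
        "?\<eta> \<otimes>\<^bsub>dual_group G\<^esub> \<xi> = \<one>\<^bsub>dual_group G\<^esub>"
      by (auto simp: defs norm_inverse Pi_iff fun_eq_iff restrict_def extensional_def)
    then show "\<exists>\<eta>\<in>carrier (dual_group G). \<eta> \<otimes>\<^bsub>dual_group G\<^esub> \<xi> = \<one>\<^bsub>dual_group G\<^esub>"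
      by blast
  qed (auto simp: defs norm_mult Pi_iff fun_eq_iff restrict_def extensional_def)
qed

lemma stft_in_cfun_space:
  "stft G g f \<in> cfun_space (carrier G \<times> carrier (dual_group G))"
  by (simp add: stft_def cfun_space_def)

end

theory Submission
  imports Defs "Jordan_Normal_Form.Char_Poly"
begin

text \<open>
  The short-time Fourier transform with window \<open>g\<close> is given by a \<open>p\<^sup>2 \<times> p\<close> matrix. Both assertions hold for every
  \<open>g\<close> such that all minors of this matrix, of every size, are nonzero. Indeed, a vector \<open>f \<noteq> 0\<close> with support
  \<open>A\<close> then cannot be annihilated by \<open>card A\<close> rows, which is the inequality
  (\<open>uncertainty_of_nonsingular_minors\<close>). Conversely, for any set \<open>Z\<close> of fewer than \<open>card A\<close> rows, a
  generic solution of the linear system given by \<open>A\<close> and \<open>Z\<close> has support exactly \<open>A\<close>, and its transform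
  vanishes exactly on \<open>Z\<close> (\<open>exists_prescribed_support_and_zeros\<close>).

  To find \<open>g\<close>, take the conjugate of \<open>g(r)\<close> to be \<open>t\<^bsup>w(r)\<^esup>\<close> with \<open>w(r) = 2\<^bsup>p - r\<^esup>\<close> for \<open>0 \<le> r < p\<close>. Each minor is
  a polynomial in \<open>t\<close>, and it suffices that none of these finitely many polynomials is zero. In the
  Leibniz expansion, a permutation matches each column \<open>y\<close> with a row \<open>(x, \<xi>)\<close> and contributes a power of \<open>t\<close>
  with exponent \<open>\<Sum>y. w(y - x)\<close>. An exchange argument shows that the largest exponent determines, for each
  column \<open>y\<close>, the shift \<open>x\<close> of the row it is matched with (\<open>unique_max_assignment\<close>). Hence the leading coefficient is, up
  to sign, a product of minors of the Fourier matrix of order \<open>p\<close>, one for each \<open>x\<close>. These are nonzero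
  by Chebotarev's theorem.

  Chebotarev's theorem is proved by factoring a minor \<open>det (z\<^sub>j\<^bsup>m\<^sub>i\<^esup>)\<close>, with \<open>z\<^sub>j = \<omega>\<^bsup>y\<^sub>j\<^esup>\<close>, as a
  Vandermonde determinant times the determinant of the Newton coefficients of the monomials \<open>X\<^bsup>m\<^sub>i\<^esup>\<close> at the
  nodes \<open>z\<^sub>j\<close>. Replacing \<open>\<omega>\<close> by \<open>1\<close> turns the second factor into a determinant of binomial
  coefficients, which is prime to \<open>p\<close>; and an integer polynomial that vanishes at \<open>\<omega>\<close> has a value divisible by \<open>p\<close>
  at \<open>1\<close> (\<open>prime_dvd_int_poly_at_1\<close>).
\<close>

section \<open>Integer polynomials at roots of unity\<close>

lemma root_of_unity_power_mod:
  fixes u :: complex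
  assumes "u ^ p = 1"
  shows "u ^ (n mod p) = u ^ n"
proof -
  have "u ^ n = u ^ (p * (n div p) + n mod p)" by simp
  also have "\<dots> = u ^ (n mod p)" by (simp only: power_add power_mult assms power_one mult_1)
  finally show ?thesis ..
qed

text \<open>
  The value \<open>u(\<omega>)\<close> is an eigenvalue of the integer matrix that describes multiplication by
  \<open>u(\<omega>)\<close> on the generators \<open>1, \<omega>, \<dots>, \<omega>\<^sup>p\<^sup>-\<^sup>1\<close> of the additive group \<open>\<int>[\<omega>]\<close>. These
  generators need not be independent.
\<close>
lemma algebraic_int_int_poly_at_root_of_unity:
  fixes \<omega> :: complex and u :: "int poly"
  assumes p: "p > 0" and \<omega>: "\<omega> ^ p = 1"
  shows "algebraic_int (poly (of_int_poly u) \<omega>)"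
proof -
  define A :: "int mat" where "A = mat p p (\<lambda>(i, j). \<Sum>l\<le>degree u. if (i + l) mod p = j then coeff u l else 0)"
  define B :: "complex mat" where "B = map_mat of_int A"
  define v where "v = vec p (\<lambda>i. \<omega> ^ i)"
  let ?t = "poly (of_int_poly u) \<omega> :: complex"
  have A: "A \<in> carrier_mat p p" and B: "B \<in> carrier_mat p p" and v: "v \<in> carrier_vec p"
    by (auto simp: A_def B_def v_def)
  have t: "?t = (\<Sum>l\<le>degree u. of_int (coeff u l) * \<omega> ^ l)"
    by (simp add: poly_altdef)
  have "B *\<^sub>v v = ?t \<cdot>\<^sub>v v"
  proof (rule eq_vecI)
    fix i assume "i < dim_vec (?t \<cdot>\<^sub>v v)"
    then have i: "i < p" by (simp add: v_def)
    have "(B *\<^sub>v v) $ i = (\<Sum>j<p. \<Sum>l\<le>degree u. if (i + l) mod p = j then of_int (coeff u l) * \<omega> ^ j else 0)"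
      using i by (auto simp: B_def A_def v_def scalar_prod_def sum_distrib_right atLeast0LessThan intro!: sum.cong)
    also have "\<dots> = (\<Sum>l\<le>degree u. of_int (coeff u l) * \<omega> ^ ((i + l) mod p))"
      using p by (subst sum.swap) (simp add: sum.delta)
    also have "\<dots> = ?t * \<omega> ^ i"
      unfolding root_of_unity_power_mod[OF \<omega>] t sum_distrib_right by (simp add: power_add mult_ac)
    finally show "(B *\<^sub>v v) $ i = (?t \<cdot>\<^sub>v v) $ i" using i by (simp add: v_def)
  qed (auto simp: B_def A_def v_def)
  moreover have "v \<noteq> 0\<^sub>v p"
  proof
    assume "v = 0\<^sub>v p"
    then have "v $ 0 = 0" using p by simp
    with p show False by (simp add: v_def)
  qed
  ultimately have "eigenvalue B ?t"
    using B v unfolding eigenvalue_def eigenvector_def by auto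
  then have "poly (char_poly B) ?t = 0"
    using eigenvalue_root_char_poly[OF B] by simp
  moreover have "char_poly B = of_int_poly (char_poly A)"
    unfolding B_def by (rule of_int_hom.char_poly_hom[OF A])
  moreover have "lead_coeff (char_poly A) = 1"
    using degree_monic_char_poly[OF A] by auto
  ultimately show ?thesis
    unfolding algebraic_int_altdef_ipoly by auto
qed

text \<open>Expand by the binomial theorem; \<open>p\<close> divides the inner binomial coefficients.\<close>
lemma one_minus_root_of_unity_power_prime:
  fixes \<omega> :: complex
  assumes p: "prime p" and \<omega>: "\<omega> ^ p = 1"
  obtains u :: "int poly" where "(1 - \<omega>) ^ p = of_nat p * poly (of_int_poly u) \<omega>"
proof -
  have p1: "p > 1" using p prime_gt_1_nat by blast
  \<comment> \<open>The two outer terms of the expansion are \<open>1\<close> and \<open>(-\<omega>)\<^sup>p = (-1)\<^sup>p\<close>; for \<open>p = 2\<close> they add up to \<open>2\<close>, not to \<open>0\<close>.\<close>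
  have "\<exists>e :: int. 1 + (-1) ^ p = int p * e"
  proof (cases "p = 2")
    case True then show ?thesis by (intro exI[of _ 1]) simp
  next
    case False
    then have "odd p" using p by (metis primes_dvd_imp_eq two_is_prime_nat)
    then show ?thesis by (intro exI[of _ 0]) simp
  qed
  then obtain e :: int where e: "1 + (-1) ^ p = int p * e" ..
  have "complex_of_int (1 + (-1) ^ p) = of_int (int p * e)" unfolding e ..
  then have e': "1 + (-1) ^ p = of_nat p * (of_int e :: complex)" by simp
  define u :: "int poly" where "u = [:e:] + (\<Sum>i\<in>{1..<p}. Polynomial.monom ((-1) ^ i * int ((p choose i) div p)) i)"
  have ch: "of_nat (p choose i) = of_nat p * (of_nat ((p choose i) div p) :: complex)" if "i \<in> {1..<p}" for i
  proof -
    have "p dvd p choose i" using that p by (intro dvd_choose_prime) auto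
    then have "p choose i = p * ((p choose i) div p)" by simp
    then show ?thesis by (metis of_nat_mult)
  qed
  have "(1 - \<omega>) ^ p = (- \<omega> + 1) ^ p" by simp
  also have "\<dots> = (\<Sum>i\<le>p. of_nat (p choose i) * (- \<omega>) ^ i)"
    by (subst binomial_ring) simp
  also have "{..p} = insert 0 (insert p {1..<p})" using p1 by auto
  also have "(\<Sum>i\<in>insert 0 (insert p {1..<p}). of_nat (p choose i) * (- \<omega>) ^ i)
      = 1 + (- \<omega>) ^ p + (\<Sum>i\<in>{1..<p}. of_nat (p choose i) * (- \<omega>) ^ i)"
    using p1 by simp
  also have "(- \<omega>) ^ p = (-1) ^ p" using \<omega> by (metis mult_1_right power_minus)
  also have "(\<Sum>i\<in>{1..<p}. of_nat (p choose i) * (- \<omega>) ^ i)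
      = of_nat p * (\<Sum>i\<in>{1..<p}. (-1) ^ i * of_nat ((p choose i) div p) * \<omega> ^ i)"
    unfolding sum_distrib_left
    by (rule sum.cong) (simp_all only: ch power_minus[of \<omega>] mult_ac)
  finally have "(1 - \<omega>) ^ p = of_nat p * poly (of_int_poly u) \<omega>"
    unfolding e' u_def
    by (simp add: of_int_poly_hom.hom_add of_int_poly_hom.hom_sum of_int_hom.map_poly_pCons_hom
        poly_sum poly_monom algebra_simps)
  then show ?thesis by (rule that)
qed

text \<open>
  For \<open>\<omega> \<noteq> 1\<close> this expresses reduction modulo the prime ideal \<open>(1 - \<omega>)\<close> of \<open>\<int>[\<omega>]\<close>, whose residue
  field has \<open>p\<close> elements. The integer \<open>m = q(1)\<close> is a multiple \<open>(1 - \<omega>) s(\<omega>)\<close> of \<open>1 - \<omega>\<close>, so \<open>m\<^sup>p / p\<close> lies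
  in \<open>\<int>[\<omega>]\<close> by the preceding lemma. It is rational and an algebraic integer, hence an integer.
\<close>
lemma prime_dvd_int_poly_at_1:
  fixes \<omega> :: complex and q :: "int poly"
  assumes p: "prime p" and \<omega>: "\<omega> ^ p = 1" and q: "poly (of_int_poly q) \<omega> = 0"
  shows "int p dvd poly q 1"
proof -
  have "poly (q - [:poly q 1:]) 1 = 0" by simp
  then obtain s where s: "q - [:poly q 1:] = [:-1, 1:] * s"
    unfolding poly_eq_0_iff_dvd by (auto elim: dvdE)
  have p0: "p > 0" using p prime_gt_0_nat by blast
  obtain u where u: "(1 - \<omega>) ^ p = of_nat p * poly (of_int_poly u) \<omega>"
    using one_minus_root_of_unity_power_prime[OF p \<omega>] .
  let ?m = "poly q 1"
  have "q = [:?m:] + [:-1, 1:] * s" using s by (simp add: algebra_simps)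
  then have "poly (of_int_poly q) \<omega> = poly (of_int_poly ([:?m:] + [:-1, 1:] * s)) \<omega>" by (rule arg_cong)
  then have "0 = of_int ?m + (\<omega> - 1) * poly (of_int_poly s) \<omega>"
    unfolding q of_int_poly_hom.hom_add of_int_poly_hom.hom_mult poly_add poly_mult
    by (simp add: of_int_hom.map_poly_pCons_hom)
  then have "of_int ?m = (1 - \<omega>) * poly (of_int_poly s) \<omega>" by (simp add: algebra_simps)
  then have "of_int ?m ^ p = ((1 - \<omega>) * poly (of_int_poly s) \<omega>) ^ p" by (rule arg_cong)
  also have "\<dots> = of_nat p * poly (of_int_poly (u * s ^ p)) \<omega>"
    by (simp add: power_mult_distrib u of_int_poly_hom.hom_mult of_int_poly_hom.hom_power)
  finally have eq: "of_int ?m ^ p / of_nat p = poly (of_int_poly (u * s ^ p)) \<omega>"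
    using p0 by (simp add: field_simps)
  have "algebraic_int (of_int ?m ^ p / of_nat p :: complex)"
    unfolding eq by (rule algebraic_int_int_poly_at_root_of_unity[OF p0 \<omega>])
  then have "of_int ?m ^ p / of_nat p \<in> (\<int> :: complex set)"
    by (rule rational_algebraic_int_is_int) auto
  then obtain k where "of_int ?m ^ p / of_nat p = (of_int k :: complex)" by (auto elim: Ints_cases)
  then have "of_int (?m ^ p) = (of_int (int p * k) :: complex)"
    using p0 by (simp add: field_simps)
  then have "?m ^ p = int p * k" by (simp only: of_int_eq_iff)
  then have "int p dvd ?m ^ p" by simp
  then show ?thesis using p prime_dvd_power_int by simp
qed

section \<open>Minors of the Fourier matrix of prime order\<close>

text \<open>
  \<open>newton_coeff z m k\<close> is the coefficient of \<open>\<Prod>l<k. X - z l\<close> in the Newton expansion of \<open>X\<^sup>m\<close>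
  at the nodes \<open>z 0, z 1, \<dots>\<close>; as a polynomial in the nodes it is the complete homogeneous symmetric
  polynomial of degree \<open>m - k\<close> in \<open>z 0, \<dots>, z k\<close>. The recursion, which follows from
  \<open>X = (X - z k) + z k\<close>, has the advantage that no division is needed, so that the nodes may be
  equal.
\<close>
fun newton_coeff :: "(nat \<Rightarrow> 'a :: comm_ring_1) \<Rightarrow> nat \<Rightarrow> nat \<Rightarrow> 'a" where
  "newton_coeff z 0 k = (if k = 0 then 1 else 0)"
| "newton_coeff z (Suc m) 0 = z 0 * newton_coeff z m 0"
| "newton_coeff z (Suc m) (Suc k) = newton_coeff z m k + z (Suc k) * newton_coeff z m (Suc k)"

lemma newton_coeff_eq_0: "m < k \<Longrightarrow> newton_coeff z m k = 0"
  by (induction z m k rule: newton_coeff.induct) auto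

lemma newton_coeff_diag: "newton_coeff z m m = 1"
  by (induction m) (auto simp: newton_coeff_eq_0)

lemma newton_coeff_1: "newton_coeff (\<lambda>_. 1) m k = of_nat (m choose k)"
proof (induction m arbitrary: k)
  case 0 show ?case by (cases k) auto
next
  case (Suc m) then show ?case by (cases k) auto
qed

lemma (in comm_ring_hom) hom_newton_coeff:
  "hom (newton_coeff z m k) = newton_coeff (\<lambda>i. hom (z i)) m k"
  by (induction z m k rule: newton_coeff.induct) (auto simp: hom_distribs)

lemma power_eq_newton:
  fixes x :: "'a :: comm_ring_1"
  shows "x ^ m = (\<Sum>k\<le>m. newton_coeff z m k * (\<Prod>l<k. x - z l))"
proof (induction m)
  case (Suc m)
  let ?N = "\<lambda>k. \<Prod>l<k. x - z l" and ?R = "newton_coeff z"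
  have "x ^ Suc m = (\<Sum>k\<le>m. ?R m k * (x * ?N k))"
    by (simp add: Suc sum_distrib_left mult_ac)
  also have "\<dots> = (\<Sum>k\<le>m. ?R m k * ?N (Suc k)) + (\<Sum>k\<le>m. z k * ?R m k * ?N k)"
    by (simp add: sum.distrib[symmetric] algebra_simps)
  also have "(\<Sum>k\<le>m. z k * ?R m k * ?N k) = (\<Sum>k\<le>Suc m. z k * ?R m k * ?N k)"
    by (simp add: newton_coeff_eq_0)
  also have "\<dots> = z 0 * ?R m 0 + (\<Sum>k\<le>m. z (Suc k) * ?R m (Suc k) * ?N (Suc k))"
    by (subst sum.atMost_Suc_shift) simp
  also have "(\<Sum>k\<le>m. ?R m k * ?N (Suc k)) + \<dots> = (\<Sum>k\<le>Suc m. ?R (Suc m) k * ?N k)"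
    by (subst sum.atMost_Suc_shift) (simp add: sum.distrib[symmetric] algebra_simps)
  finally show ?case .
qed simp

lemma node_power_eq_newton:
  assumes "j < n"
  shows "z j ^ m = (\<Sum>k<n. newton_coeff z m k * (\<Prod>l<k. z j - z l))"
proof -
  have "(\<Prod>l<k. z j - z l) = 0" if "k \<ge> n" for k
    using that assms by (intro prod_zero) (auto intro!: bexI[of _ j])
  then have "(\<Sum>k<n. newton_coeff z m k * (\<Prod>l<k. z j - z l))
      = (\<Sum>k<max n (Suc m). newton_coeff z m k * (\<Prod>l<k. z j - z l))"
    by (intro sum.mono_neutral_left) auto
  also have "\<dots> = (\<Sum>k\<le>m. newton_coeff z m k * (\<Prod>l<k. z j - z l))"
    by (intro sum.mono_neutral_right) (auto simp: newton_coeff_eq_0)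
  finally show ?thesis using power_eq_newton by metis
qed

text \<open>
  A generalized Vandermonde determinant is the Vandermonde determinant times a factor that stays
  meaningful, and computable, when all nodes coincide.
\<close>
lemma det_node_powers:
  fixes z :: "nat \<Rightarrow> 'a :: idom"
  shows "det (mat n n (\<lambda>(i, j). z j ^ m i))
    = det (mat n n (\<lambda>(i, k). newton_coeff z (m i) k)) * (\<Prod>k<n. \<Prod>l<k. z k - z l)"
proof -
  define R where "R = mat n n (\<lambda>(i, k). newton_coeff z (m i) k)"
  define N where "N = mat n n (\<lambda>(k, j). \<Prod>l<k. z j - z l)"
  have [simp]: "R \<in> carrier_mat n n" "N \<in> carrier_mat n n" by (auto simp: R_def N_def)
  have "mat n n (\<lambda>(i, j). z j ^ m i) = R * N"
    by (rule eq_matI) (auto simp: R_def N_def scalar_prod_def node_power_eq_newton atLeast0LessThan)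
  then have "det (mat n n (\<lambda>(i, j). z j ^ m i)) = det R * det N"
    by (simp add: det_mult[of _ n])
  also have "upper_triangular N"
    by (auto simp: N_def upper_triangular_def intro!: prod_zero)
  then have "det N = (\<Prod>k<n. \<Prod>l<k. z k - z l)"
    by (subst det_upper_triangular[of _ n])
       (auto simp: prod_list_diag_prod atLeast0LessThan N_def intro!: prod.cong)
  finally show ?thesis by (simp add: R_def)
qed

lemma det_vandermonde:
  fixes z :: "nat \<Rightarrow> 'a :: idom"
  shows "det (mat n n (\<lambda>(i, j). z j ^ i)) = (\<Prod>k<n. \<Prod>l<k. z k - z l)"
proof -
  have "det (mat n n (\<lambda>(i, k). newton_coeff z i k)) = 1"
    by (subst det_lower_triangular[of n])
       (auto simp: newton_coeff_eq_0 newton_coeff_diag prod_list_diag_prod)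
  then show ?thesis using det_node_powers[of n z "\<lambda>i. i"] by simp
qed

text \<open>
  With \<open>0, 1, 2, \<dots>\<close> as nodes, the Newton basis polynomials are the falling factorials
  \<open>l! (X choose l)\<close>. Expanding \<open>m\<^sub>i\<^sup>k\<close> in them therefore writes the Vandermonde matrix of the \<open>m\<^sub>i\<close>
  as the matrix of binomial coefficients times an integer matrix.
\<close>
lemma det_binomial_dvd_vandermonde:
  fixes m :: "nat \<Rightarrow> nat"
  shows "det (mat n n (\<lambda>(i, k). int (m i choose k))) dvd (\<Prod>k<n. \<Prod>l<k. int (m k) - int (m l))"
proof -
  define C where "C = mat n n (\<lambda>(i, k). int (m i choose k))"
  define U :: "int mat" where "U = mat n n (\<lambda>(l, k). fact l * newton_coeff int k l)"
  have [simp]: "C \<in> carrier_mat n n" "U \<in> carrier_mat n n" by (auto simp: C_def U_def)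
  have ff: "(\<Prod>l<k. int a - int l) = fact k * int (a choose k)" for a k
  proof -
    have "(\<Prod>l<k. of_nat a - of_nat l) = fact k * (of_nat a gchoose k :: rat)"
      by (simp add: gbinomial_mult_fact atLeast0LessThan)
    then have "rat_of_int (\<Prod>l<k. int a - int l) = rat_of_int (fact k * int (a choose k))"
      by (simp add: binomial_gbinomial)
    then show ?thesis by (simp only: of_int_eq_iff)
  qed
  have "int (m i) ^ k = (\<Sum>l<n. int (m i choose l) * (fact l * newton_coeff int k l))"
    if "k < n" for i k
  proof -
    have "int (m i) ^ k = (\<Sum>l\<le>k. newton_coeff int k l * (\<Prod>t<l. int (m i) - int t))"
      by (rule power_eq_newton)
    also have "\<dots> = (\<Sum>l<n. newton_coeff int k l * (\<Prod>t<l. int (m i) - int t))"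
      using that by (intro sum.mono_neutral_left) (auto simp: newton_coeff_eq_0)
    finally show ?thesis by (simp add: ff mult_ac)
  qed
  then have "transpose_mat (mat n n (\<lambda>(k, i). int (m i) ^ k)) = C * U"
    by (intro eq_matI) (auto simp: C_def U_def scalar_prod_def atLeast0LessThan)
  then have "det (transpose_mat (mat n n (\<lambda>(k, i). int (m i) ^ k))) = det C * det U"
    by (simp add: det_mult[of _ n])
  then have "det (mat n n (\<lambda>(k, i). int (m i) ^ k)) = det C * det U"
    by (subst (asm) det_transpose[of _ n]) auto
  then show ?thesis by (simp add: det_vandermonde C_def)
qed

text \<open>
  Chebotarev's theorem: all minors of the Fourier matrix of prime order are nonzero. Divide the minor
  by the Vandermonde determinant of the distinct nodes \<open>\<omega>\<^bsup>y j\<^esup>\<close>. If the quotient were zero, then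
  \<open>p\<close> would divide the value of the same expression at \<open>\<omega> = 1\<close>, which is the determinant of
  the binomial coefficients \<open>m i choose k\<close>, and hence \<open>p\<close> would divide one of the differences
  \<open>m k - m l\<close>.
\<close>
theorem chebotarev:
  fixes \<omega> :: complex and m y :: "nat \<Rightarrow> nat"
  assumes p: "prime p" and \<omega>: "\<omega> ^ p = 1" and inj\<omega>: "inj_on (\<lambda>k. \<omega> ^ k) {..<p}"
    and m: "inj_on m {..<n}" "m ` {..<n} \<subseteq> {..<p}"
    and y: "inj_on y {..<n}" "y ` {..<n} \<subseteq> {..<p}"
  shows "det (mat n n (\<lambda>(i, j). \<omega> ^ (m i * y j))) \<noteq> 0"
proof
  assume 0: "det (mat n n (\<lambda>(i, j). \<omega> ^ (m i * y j))) = 0"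
  define z where "z = (\<lambda>j. \<omega> ^ y j)"
  define Z :: "nat \<Rightarrow> int poly" where "Z = (\<lambda>j. Polynomial.monom 1 (y j))"
  define D where "D = det (mat n n (\<lambda>(i, k). newton_coeff Z (m i) k))"
  let ?ev = "\<lambda>q :: int poly. poly (of_int_poly q) \<omega>"
  interpret ev: comm_ring_hom ?ev
    by unfold_locales (auto simp: of_int_poly_hom.hom_add of_int_poly_hom.hom_mult)
  have "det (mat n n (\<lambda>(i, j). z j ^ m i)) = 0"
    using 0 by (simp add: z_def power_mult[symmetric] mult.commute)
  then have "det (mat n n (\<lambda>(i, k). newton_coeff z (m i) k)) * (\<Prod>k<n. \<Prod>l<k. z k - z l) = 0"
    by (simp add: det_node_powers)
  moreover have "z k \<noteq> z l" if "k < n" "l < k" for k l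
  proof
    assume "z k = z l"
    then have "y k = y l" using inj\<omega> y(2) that unfolding z_def inj_on_def by (auto simp: image_subset_iff)
    then show False using inj_on_eq_iff[OF y(1)] that by auto
  qed
  ultimately have 1: "det (mat n n (\<lambda>(i, k). newton_coeff z (m i) k)) = 0" by auto
  have "?ev D = det (mat n n (\<lambda>(i, k). newton_coeff z (m i) k))"
    unfolding D_def ev.hom_det[symmetric]
    by (rule arg_cong[where f = det], rule eq_matI)
       (auto simp: ev.hom_newton_coeff Z_def z_def poly_monom of_int_hom.map_poly_hom_monom)
  also note 1
  finally have "?ev D = 0" .
  then have "int p dvd poly D 1"
    by (rule prime_dvd_int_poly_at_1[OF p \<omega>])
  also have "poly D 1 = det (mat n n (\<lambda>(i, k). int (m i choose k)))"
    unfolding D_def comm_ring_hom.hom_det[OF poly_hom.comm_ring_hom_axioms, symmetric]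
    by (rule arg_cong[where f = det], rule eq_matI)
       (auto simp: poly_hom.hom_newton_coeff Z_def poly_monom newton_coeff_1)
  also have "\<dots> dvd (\<Prod>k<n. \<Prod>l<k. int (m k) - int (m l))"
    by (rule det_binomial_dvd_vandermonde)
  finally obtain k l where kl: "k < n" "l < k" "int p dvd int (m k) - int (m l)"
    using p by (auto simp: prime_dvd_prod_iff)
  have "k < n" "l < n" using kl by auto
  then have "m k < p" "m l < p" using m(2) by auto
  then have "int (m k) mod int p = int (m k)" "int (m l) mod int p = int (m l)" by auto
  with kl(3) have "m k = m l" by (simp add: mod_eq_dvd_iff[symmetric])
  then show False using inj_on_eq_iff[OF m(1)] kl by auto
qed

section \<open>Nonsingular submatrices\<close>

text \<open>
  The submatrix of \<open>E\<close> with rows \<open>S\<close> and columns \<open>A\<close> has trivial kernel; if \<open>S\<close> and \<open>A\<close> are finite of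
  equal size, this says that the corresponding minor is nonzero. The rows and columns of \<open>E\<close> are
  not enumerated, so the sign of the minor is left undetermined.
\<close>
definition nonsingular_on :: "('r \<Rightarrow> 'c \<Rightarrow> complex) \<Rightarrow> 'r set \<Rightarrow> 'c set \<Rightarrow> bool" where
  "nonsingular_on E S A \<longleftrightarrow> (\<forall>v. (\<forall>s\<in>S. (\<Sum>y\<in>A. E s y * v y) = 0) \<longrightarrow> (\<forall>y\<in>A. v y = 0))"

text \<open>All minors of the \<open>R \<times> C\<close> matrix \<open>E\<close>, of every size, are nonzero.\<close>
definition all_minors_nonsingular :: "('r \<Rightarrow> 'c \<Rightarrow> complex) \<Rightarrow> 'r set \<Rightarrow> 'c set \<Rightarrow> bool" where
  "all_minors_nonsingular E R C \<longleftrightarrow>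
    (\<forall>S A. S \<subseteq> R \<longrightarrow> A \<subseteq> C \<longrightarrow> card S = card A \<longrightarrow> nonsingular_on E S A)"

lemma det_mat_eq_0_iff:
  fixes F :: "nat \<Rightarrow> nat \<Rightarrow> 'a :: idom"
  shows "det (mat n n (\<lambda>(i, j). F i j)) = 0 \<longleftrightarrow>
    (\<exists>v. (\<exists>j<n. v j \<noteq> 0) \<and> (\<forall>i<n. (\<Sum>j<n. F i j * v j) = 0))" (is "?L \<longleftrightarrow> ?R")
proof -
  let ?M = "mat n n (\<lambda>(i, j). F i j)"
  have M: "?M \<in> carrier_mat n n" by simp
  have prod: "(?M *\<^sub>v v) $ i = (\<Sum>j<n. F i j * v $ j)" if "i < n" "v \<in> carrier_vec n" for v i
    using that by (auto simp: scalar_prod_def atLeast0LessThan)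
  show ?thesis
  proof
    assume ?L
    then obtain v where v: "v \<in> carrier_vec n" "v \<noteq> 0\<^sub>v n" "?M *\<^sub>v v = 0\<^sub>v n"
      unfolding det_0_iff_vec_prod_zero[OF M] by blast
    have "\<exists>j<n. v $ j \<noteq> 0"
    proof (rule ccontr)
      assume "\<not> ?thesis"
      then have "v = 0\<^sub>v n" using v(1) by (intro eq_vecI) auto
      with v(2) show False ..
    qed
    moreover have "(\<Sum>j<n. F i j * v $ j) = 0" if "i < n" for i
      using prod[OF that v(1)] that unfolding v(3) by simp
    ultimately show ?R by (intro exI[of _ "\<lambda>j. v $ j"]) auto
  next
    assume ?R
    then obtain v j where v: "j < n" "v j \<noteq> 0" "\<And>i. i < n \<Longrightarrow> (\<Sum>j<n. F i j * v j) = 0" by blast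
    have "vec n v \<noteq> 0\<^sub>v n"
    proof
      assume "vec n v = 0\<^sub>v n"
      then have "vec n v $ j = 0\<^sub>v n $ j" by simp
      with v show False by simp
    qed
    moreover have "?M *\<^sub>v vec n v = 0\<^sub>v n"
    proof (rule eq_vecI)
      fix i assume "i < dim_vec (0\<^sub>v n :: 'a vec)"
      then have i: "i < n" by simp
      show "(?M *\<^sub>v vec n v) $ i = 0\<^sub>v n $ i"
        using i v(3)[OF i] prod[OF i, of "vec n v"] by simp
    qed simp
    ultimately show ?L unfolding det_0_iff_vec_prod_zero[OF M] by (intro exI[of _ "vec n v"]) auto
  qed
qed

lemma nonsingular_on_iff_det:
  assumes a: "bij_betw a {..<n} S" and b: "bij_betw b {..<n} A"
  shows "nonsingular_on E S A \<longleftrightarrow> det (mat n n (\<lambda>(i, j). E (a i) (b j))) \<noteq> 0"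
proof -
  have sum: "(\<Sum>y\<in>A. E s y * v y) = (\<Sum>j<n. E s (b j) * v (b j))" for s v
    by (rule sum.reindex_bij_betw[OF b, symmetric])
  have S: "S = a ` {..<n}" and A: "A = b ` {..<n}"
    using a b by (auto simp: bij_betw_def)
  show ?thesis
  proof
    assume ns: "nonsingular_on E S A"
    show "det (mat n n (\<lambda>(i, j). E (a i) (b j))) \<noteq> 0"
    proof
      assume "det (mat n n (\<lambda>(i, j). E (a i) (b j))) = 0"
      then obtain v j where v: "j < n" "v j \<noteq> 0" "\<And>i. i < n \<Longrightarrow> (\<Sum>j<n. E (a i) (b j) * v j) = 0"
        unfolding det_mat_eq_0_iff by blast
      define v' where "v' = v \<circ> the_inv_into {..<n} b"
      have v': "v' (b j) = v j" if "j < n" for j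
        using b that by (auto simp: v'_def bij_betw_def the_inv_into_f_f)
      have "\<forall>s\<in>S. (\<Sum>y\<in>A. E s y * v' y) = 0"
        unfolding sum S by (auto simp: v' v(3))
      with ns have "\<forall>y\<in>A. v' y = 0" unfolding nonsingular_on_def by blast
      with v v' A show False by auto
    qed
  next
    assume d: "det (mat n n (\<lambda>(i, j). E (a i) (b j))) \<noteq> 0"
    show "nonsingular_on E S A"
      unfolding nonsingular_on_def sum
    proof (intro allI impI)
      fix v assume "\<forall>s\<in>S. (\<Sum>j<n. E s (b j) * v (b j)) = 0"
      then have *: "\<forall>i<n. (\<Sum>j<n. E (a i) (b j) * v (b j)) = 0" using S by auto
      have "\<forall>j<n. v (b j) = 0"
      proof (rule ccontr)
        assume "\<not> ?thesis"
        then have "\<exists>j<n. v (b j) \<noteq> 0" by auto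
        with * have "det (mat n n (\<lambda>(i, j). E (a i) (b j))) = 0"
          unfolding det_mat_eq_0_iff by (intro exI[of _ "\<lambda>j. v (b j)"]) simp
        with d show False ..
      qed
      then show "\<forall>y\<in>A. v y = 0" using A by auto
    qed
  qed
qed

section \<open>Maximal assignments and leading coefficients of determinants\<close>

lemma card_permuted_fibre:
  fixes n :: nat
  assumes \<rho>: "\<rho> permutes {0..<n}"
  shows "card {j. j < n \<and> X (\<rho> j) = x} = card {i. i < n \<and> X i = x}"
proof -
  have "\<rho> ` {j. j < n \<and> X (\<rho> j) = x} = {i. i < n \<and> X i = x}"
  proof (intro equalityI subsetI)
    fix i assume i: "i \<in> {i. i < n \<and> X i = x}"
    then have "i \<in> {0..<n}" by simp
    then obtain j where "i = \<rho> j" "j \<in> {0..<n}" using permutes_image[OF \<rho>] by blast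
    with i show "i \<in> \<rho> ` {j. j < n \<and> X (\<rho> j) = x}" by simp
  next
    fix i assume "i \<in> \<rho> ` {j. j < n \<and> X (\<rho> j) = x}"
    then obtain j where j: "i = \<rho> j" "j < n" "X i = x" by blast
    with permutes_in_image[OF \<rho>, of j] show "i \<in> {i. i < n \<and> X i = x}" by simp
  qed
  moreover have "card (\<rho> ` {j. j < n \<and> X (\<rho> j) = x}) = card {j. j < n \<and> X (\<rho> j) = x}"
    by (rule card_image[OF permutes_inj_on[OF \<rho>]])
  ultimately show ?thesis by simp
qed

text \<open>
  A permutation \<open>\<sigma>\<close> of \<open>{0..<n}\<close> assigns to each \<open>j\<close> the partner \<open>\<sigma> j\<close>, and \<open>d j i\<close> is the cost of the pair
  \<open>(j, i)\<close>. A pair of cost \<open>r\<close> has weight \<open>2\<^bsup>p - r\<^esup>\<close>, the point being that, for \<open>r < p\<close>, two pairs of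
  larger cost never outweigh one pair of cost \<open>r\<close>.
\<close>
definition assignment_weight :: "nat \<Rightarrow> (nat \<Rightarrow> nat \<Rightarrow> nat) \<Rightarrow> nat \<Rightarrow> (nat \<Rightarrow> nat) \<Rightarrow> nat" where
  "assignment_weight p d n \<sigma> = (\<Sum>j\<in>{0..<n}. 2 ^ (p - d j (\<sigma> j)))"

text \<open>
  The costs that occur below are \<open>d j i = (y\<^sub>j - X i) mod p\<close> with distinct \<open>y\<^sub>j\<close>. Several \<open>i\<close> may have the
  same \<open>X i\<close>, and an assignment is only determined by its weight up to the exchange of such \<open>i\<close>.
\<close>
context
  fixes p n :: nat and d :: "nat \<Rightarrow> nat \<Rightarrow> nat" and X :: "nat \<Rightarrow> 'x"
  assumes less: "\<And>j i. j < n \<Longrightarrow> i < n \<Longrightarrow> d j i < p"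
    and col: "\<And>i j j'. i < n \<Longrightarrow> j < n \<Longrightarrow> j' < n \<Longrightarrow> d j i = d j' i \<Longrightarrow> j = j'"
    and grp: "\<And>j i i'. j < n \<Longrightarrow> i < n \<Longrightarrow> i' < n \<Longrightarrow> d j i = d j i' \<longleftrightarrow> X i = X i'"
begin

text \<open>
  Suppose that \<open>\<sigma>\<close> and \<open>\<tau>\<close> put \<open>j0\<close> into different classes of \<open>X\<close>, and that the pair \<open>(j0, \<sigma> j0)\<close> costs
  at most as much as any pair \<open>(j, \<tau> j)\<close> for which \<open>\<sigma>\<close> and \<open>\<tau>\<close> put \<open>j\<close> into different classes. Some \<open>j1\<close> is put into the class of \<open>\<sigma> j0\<close> by \<open>\<tau>\<close> but not by
  \<open>\<sigma>\<close>. Swapping the partners of \<open>j0\<close> and \<open>j1\<close> in \<open>\<tau>\<close> then increases the weight.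
\<close>
lemma assignment_exchange:
  assumes \<sigma>: "\<sigma> permutes {0..<n}" and \<tau>: "\<tau> permutes {0..<n}"
    and j0: "j0 < n" "X (\<sigma> j0) \<noteq> X (\<tau> j0)"
    and min: "\<And>j. j < n \<Longrightarrow> X (\<sigma> j) \<noteq> X (\<tau> j) \<Longrightarrow> d j0 (\<sigma> j0) \<le> d j (\<tau> j)"
  shows "\<exists>\<tau>'. \<tau>' permutes {0..<n} \<and> assignment_weight p d n \<tau> < assignment_weight p d n \<tau>'"
proof -
  have lt: "\<sigma> j < n" "\<tau> j < n" if "j < n" for j
    using that permutes_in_image[OF \<sigma>, of j] permutes_in_image[OF \<tau>, of j] by auto
  define x0 where "x0 = X (\<sigma> j0)"
  have card: "card {j. j < n \<and> X (\<rho> j) = x0} = card {i. i < n \<and> X i = x0}"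
    if "\<rho> permutes {0..<n}" for \<rho>
    using card_permuted_fibre[OF that] .
  have "\<not> {j. j < n \<and> X (\<tau> j) = x0} \<subseteq> {j. j < n \<and> X (\<sigma> j) = x0}"
  proof
    assume sub: "{j. j < n \<and> X (\<tau> j) = x0} \<subseteq> {j. j < n \<and> X (\<sigma> j) = x0}"
    have "{j. j < n \<and> X (\<tau> j) = x0} = {j. j < n \<and> X (\<sigma> j) = x0}"
      using sub by (rule card_subset_eq[rotated]) (simp_all only: card[OF \<sigma>] card[OF \<tau>], simp)
    then have "j0 \<in> {j. j < n \<and> X (\<tau> j) = x0} \<longleftrightarrow> j0 \<in> {j. j < n \<and> X (\<sigma> j) = x0}" by (rule arg_cong)
    with j0 show False by (simp add: x0_def)
  qed
  then obtain j1 where j1: "j1 < n" "X (\<tau> j1) = x0" "X (\<sigma> j1) \<noteq> x0" by auto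
  have ne: "j0 \<noteq> j1" using j0 j1 by (auto simp: x0_def)
  define \<tau>' where "\<tau>' = \<tau> \<circ> transpose j0 j1"
  have \<tau>': "\<tau>' permutes {0..<n}"
    unfolding \<tau>'_def using j0 j1 by (intro permutes_compose[OF _ \<tau>] permutes_swap_id) auto
  have v: "\<tau>' j0 = \<tau> j1" "\<tau>' j1 = \<tau> j0" "\<And>j. j \<noteq> j0 \<Longrightarrow> j \<noteq> j1 \<Longrightarrow> \<tau>' j = \<tau> j"
    by (auto simp: \<tau>'_def transpose_apply_other)
  let ?w = "\<lambda>j i. (2::nat) ^ (p - d j i)" and ?rest = "{0..<n} - {j0} - {j1}"
  have split: "assignment_weight p d n \<rho> = ?w j0 (\<rho> j0) + (?w j1 (\<rho> j1) + (\<Sum>j\<in>?rest. ?w j (\<rho> j)))" for \<rho>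
    unfolding assignment_weight_def using j0 j1 ne
    by (subst sum.remove[of _ j0], simp, simp, subst sum.remove[of _ j1]) auto
  define r where "r = d j0 (\<sigma> j0)"
  have r: "r < p" unfolding r_def by (rule less) (use j0 lt in auto)
  have r1: "d j0 (\<tau> j1) = r"
    unfolding r_def using grp[of j0 "\<tau> j1" "\<sigma> j0"] j0 j1 lt by (auto simp: x0_def)
  have "d j0 (\<tau> j0) \<noteq> r"
    unfolding r_def using grp[of j0 "\<tau> j0" "\<sigma> j0"] j0 lt by auto
  moreover have "r \<le> d j0 (\<tau> j0)" unfolding r_def by (rule min) (use j0 in auto)
  ultimately have "?w j0 (\<tau> j0) \<le> 2 ^ (p - Suc r)" by (intro power_increasing) auto
  moreover
  have "d j1 (\<tau> j1) \<noteq> r"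
    using col[of "\<tau> j1" j0 j1] r1 j0 j1 lt ne by auto
  moreover have "r \<le> d j1 (\<tau> j1)" unfolding r_def by (rule min) (use j1 in auto)
  ultimately have "?w j0 (\<tau> j0) \<le> 2 ^ (p - Suc r)" "?w j1 (\<tau> j1) \<le> 2 ^ (p - Suc r)"
    by (auto intro!: power_increasing)
  moreover have "(2::nat) ^ (p - r) = 2 ^ (p - Suc r) + 2 ^ (p - Suc r)"
    using r by (metis Suc_diff_Suc mult_2 power_Suc)
  moreover have "(0::nat) < ?w j1 (\<tau> j0)" by simp
  moreover have "(\<Sum>j\<in>?rest. ?w j (\<tau>' j)) = (\<Sum>j\<in>?rest. ?w j (\<tau> j))"
    by (rule sum.cong) (auto simp: v)
  ultimately have "assignment_weight p d n \<tau> < assignment_weight p d n \<tau>'"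
    unfolding split v r1 by linarith
  with \<tau>' show ?thesis by blast
qed

text \<open>The assignments of maximal weight are those that agree with \<open>\<pi>\<close> up to the classes of \<open>X\<close>.\<close>
lemma unique_max_assignment:
  "\<exists>\<pi>. \<pi> permutes {0..<n} \<and> (\<forall>\<sigma>. \<sigma> permutes {0..<n} \<longrightarrow>
    (assignment_weight p d n \<sigma> = assignment_weight p d n \<pi> \<longleftrightarrow> (\<forall>j<n. X (\<sigma> j) = X (\<pi> j))))"
proof -
  let ?P = "{\<sigma>. \<sigma> permutes {0..<n}}" and ?W = "assignment_weight p d n"
  have fin: "finite ?P" by (rule finite_permutations) simp
  have "id \<in> ?P" by (simp add: permutes_id)
  then have "?P \<noteq> {}" by blast
  with fin have "Max (?W ` ?P) \<in> ?W ` ?P" by (intro Max_in) simp_all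
  then obtain \<pi> where \<pi>: "\<pi> permutes {0..<n}" "?W \<pi> = Max (?W ` ?P)" by auto
  have max: "?W \<sigma> \<le> ?W \<pi>" if "\<sigma> permutes {0..<n}" for \<sigma>
    unfolding \<pi>(2) using that fin by (intro Max_ge) auto
  have "?W \<sigma> = ?W \<pi> \<longleftrightarrow> (\<forall>j<n. X (\<sigma> j) = X (\<pi> j))" if \<sigma>: "\<sigma> permutes {0..<n}" for \<sigma>
  proof
    assume eq: "\<forall>j<n. X (\<sigma> j) = X (\<pi> j)"
    have "d j (\<sigma> j) = d j (\<pi> j)" if "j < n" for j
      using grp[of j "\<sigma> j" "\<pi> j"] eq that permutes_in_image[OF \<sigma>, of j] permutes_in_image[OF \<pi>(1), of j] by auto
    then show "?W \<sigma> = ?W \<pi>" by (simp add: assignment_weight_def)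
  next
    assume eq: "?W \<sigma> = ?W \<pi>"
    show "\<forall>j<n. X (\<sigma> j) = X (\<pi> j)"
    proof (rule ccontr)
      assume "\<not> ?thesis"
      then have D: "{j. j < n \<and> X (\<sigma> j) \<noteq> X (\<pi> j)} \<noteq> {}" (is "?D \<noteq> {}") by auto
      \<comment> \<open>The cheapest of the pairs on which \<open>\<sigma>\<close> and \<open>\<pi>\<close> disagree belongs to one of the two; the other can be improved.\<close>
      define u where "u = (\<lambda>j. min (d j (\<sigma> j)) (d j (\<pi> j)))"
      define j0 where "j0 = arg_min_on u ?D"
      have j0: "j0 \<in> ?D" unfolding j0_def by (rule arg_min_if_finite(1)) (use D in auto)
      have u: "u j0 \<le> u j" if "j \<in> ?D" for j
        using arg_min_least[of ?D j u] D that by (auto simp: j0_def)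
      consider "u j0 = d j0 (\<sigma> j0)" | "u j0 = d j0 (\<pi> j0)" by (metis u_def min_def)
      then show False
      proof cases
        case 1
        have "\<exists>\<tau>'. \<tau>' permutes {0..<n} \<and> ?W \<pi> < ?W \<tau>'"
          by (rule assignment_exchange[OF \<sigma> \<pi>(1), of j0]) (use j0 u 1 in \<open>auto simp: u_def\<close>)
        then show False using max by (meson not_less)
      next
        case 2
        have "\<exists>\<tau>'. \<tau>' permutes {0..<n} \<and> ?W \<sigma> < ?W \<tau>'"
          by (rule assignment_exchange[OF \<pi>(1) \<sigma>, of j0]) (use j0 u 2 in \<open>auto simp: u_def\<close>)
        then show False using max unfolding eq by (meson not_less)
      qed
    qed
  qed
  with \<pi>(1) show ?thesis by (intro exI[of _ \<pi>]) simp
qed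

text \<open>
  In the Leibniz expansion, the coefficient at the maximal weight collects the permutations that agree
  with \<open>\<pi>\<close> up to the classes of \<open>X\<close>. These are exactly the terms of the Leibniz expansion of a matrix
  that is block diagonal up to the order of its rows and columns.
\<close>
lemma det_weighted_nonzero:
  fixes F :: "nat \<Rightarrow> nat \<Rightarrow> 'a :: idom"
  assumes block: "\<And>\<pi>. \<pi> permutes {0..<n} \<Longrightarrow>
    det (mat n n (\<lambda>(j, i). if X i = X (\<pi> j) then F j i else 0)) \<noteq> 0"
  shows "det (mat n n (\<lambda>(j, i). Polynomial.monom (F j i) (2 ^ (p - d j i)))) \<noteq> 0" (is "det ?M \<noteq> 0")
proof -
  obtain \<pi> where \<pi>: "\<pi> permutes {0..<n}"
    "\<And>\<sigma>. \<sigma> permutes {0..<n} \<Longrightarrow>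
      assignment_weight p d n \<sigma> = assignment_weight p d n \<pi> \<longleftrightarrow> (\<forall>j<n. X (\<sigma> j) = X (\<pi> j))"
    using unique_max_assignment by blast
  let ?B = "mat n n (\<lambda>(j, i). if X i = X (\<pi> j) then F j i else 0)"
  let ?P = "{\<sigma>. \<sigma> permutes {0..<n}}" and ?W = "assignment_weight p d n"
  have in_range: "\<sigma> j < n" if "\<sigma> permutes {0..<n}" "j < n" for \<sigma> j
    using permutes_in_image[OF that(1), of j] that by simp
  have mon: "(\<Prod>j\<in>J. Polynomial.monom (f j) (e j)) = Polynomial.monom (\<Prod>j\<in>J. f j) (\<Sum>j\<in>J. e j)"
    if "finite J" for J and f :: "nat \<Rightarrow> 'a" and e
    using that by induction (auto simp: mult_monom one_pCons monom_0)
  have "det ?M = (\<Sum>\<sigma>\<in>?P. signof \<sigma> * (\<Prod>j\<in>{0..<n}. Polynomial.monom (F j (\<sigma> j)) (2 ^ (p - d j (\<sigma> j)))))"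
    by (subst det_def'[of _ n]) (auto simp: in_range intro!: sum.cong prod.cong)
  also have "\<dots> = (\<Sum>\<sigma>\<in>?P. signof \<sigma> * Polynomial.monom (\<Prod>j\<in>{0..<n}. F j (\<sigma> j)) (?W \<sigma>))"
    by (simp add: mon assignment_weight_def)
  finally have "Polynomial.coeff (det ?M) (?W \<pi>) =
      (\<Sum>\<sigma>\<in>?P. signof \<sigma> * (if ?W \<sigma> = ?W \<pi> then \<Prod>j\<in>{0..<n}. F j (\<sigma> j) else 0))"
    by (simp add: coeff_sum of_int_poly mult.commute)
  also have "\<dots> = (\<Sum>\<sigma>\<in>?P. signof \<sigma> * (\<Prod>j\<in>{0..<n}. ?B $$ (j, \<sigma> j)))"
  proof (rule sum.cong, simp)
    fix \<sigma> assume "\<sigma> \<in> ?P"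
    then have \<sigma>: "\<sigma> permutes {0..<n}" by simp
    have "(\<Prod>j\<in>{0..<n}. ?B $$ (j, \<sigma> j)) = (\<Prod>j\<in>{0..<n}. if X (\<sigma> j) = X (\<pi> j) then F j (\<sigma> j) else 0)"
      by (rule prod.cong) (auto simp: in_range[OF \<sigma>])
    also have "\<dots> = (if ?W \<sigma> = ?W \<pi> then \<Prod>j\<in>{0..<n}. F j (\<sigma> j) else 0)"
      unfolding \<pi>(2)[OF \<sigma>] by (auto intro!: prod.cong)
    finally show "signof \<sigma> * (if ?W \<sigma> = ?W \<pi> then \<Prod>j\<in>{0..<n}. F j (\<sigma> j) else 0)
      = signof \<sigma> * (\<Prod>j\<in>{0..<n}. ?B $$ (j, \<sigma> j))" by simp
  qed
  also have "\<dots> = det ?B" by (rule det_def'[symmetric]) simp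
  also have "\<dots> \<noteq> 0" by (rule block[OF \<pi>(1)])
  finally show ?thesis by auto
qed

end

section \<open>Windows with nonsingular Gabor minors\<close>

lemma chebotarev_nonsingular_on:
  fixes \<omega> :: complex and m :: "'r \<Rightarrow> nat" and y :: "'c \<Rightarrow> nat"
  assumes p: "prime p" and \<omega>: "\<omega> ^ p = 1" and inj\<omega>: "inj_on (\<lambda>k. \<omega> ^ k) {..<p}"
    and fin: "finite S" "finite A" and card: "card S = card A"
    and m: "inj_on m S" "m ` S \<subseteq> {..<p}" and y: "inj_on y A" "y ` A \<subseteq> {..<p}"
  shows "nonsingular_on (\<lambda>s c. \<omega> ^ (m s * y c)) S A"
proof -
  let ?n = "card S"
  obtain a where a: "bij_betw a {..<?n} S"
    using ex_bij_betw_nat_finite[OF fin(1)] by (auto simp: atLeast0LessThan)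
  obtain b where b: "bij_betw b {..<?n} A"
    using ex_bij_betw_nat_finite[OF fin(2)] by (auto simp: atLeast0LessThan card)
  have "inj_on (m \<circ> a) {..<?n}" "inj_on (y \<circ> b) {..<?n}"
    using a b m(1) y(1) by (auto simp: bij_betw_def intro!: comp_inj_on)
  moreover have "(m \<circ> a) ` {..<?n} \<subseteq> {..<p}" "(y \<circ> b) ` {..<?n} \<subseteq> {..<p}"
    unfolding image_comp[symmetric] bij_betw_imp_surj_on[OF a] bij_betw_imp_surj_on[OF b]
    by (rule m(2), rule y(2))
  ultimately have "det (mat ?n ?n (\<lambda>(i, j). \<omega> ^ ((m \<circ> a) i * (y \<circ> b) j))) \<noteq> 0"
    by (intro chebotarev[OF p \<omega> inj\<omega>])
  then show ?thesis
    unfolding nonsingular_on_iff_det[OF a b] by simp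
qed

text \<open>
  The blocks are indexed by the values of \<open>X\<close>. The permutation \<open>\<pi>\<close> ensures that they are square, and
  each of them is a submatrix of the Fourier matrix.
\<close>
lemma det_fourier_blocks_nonzero:
  fixes \<omega> :: complex and m y \<pi> :: "nat \<Rightarrow> nat"
  assumes p: "prime p" and \<omega>: "\<omega> ^ p = 1" and inj\<omega>: "inj_on (\<lambda>k. \<omega> ^ k) {..<p}"
    and m: "inj_on (\<lambda>i. (X i, m i)) {..<n}" "m ` {..<n} \<subseteq> {..<p}"
    and y: "inj_on y {..<n}" "y ` {..<n} \<subseteq> {..<p}"
    and \<pi>: "\<pi> permutes {0..<n}"
  shows "det (mat n n (\<lambda>(j, i). if X i = X (\<pi> j) then \<omega> ^ (y j * m i) else 0)) \<noteq> 0"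
proof
  assume "det (mat n n (\<lambda>(j, i). if X i = X (\<pi> j) then \<omega> ^ (y j * m i) else 0)) = 0"
  then obtain v i0 where v: "i0 < n" "v i0 \<noteq> 0"
    "\<And>j. j < n \<Longrightarrow> (\<Sum>i<n. (if X i = X (\<pi> j) then \<omega> ^ (y j * m i) else 0) * v i) = 0"
    unfolding det_mat_eq_0_iff by blast
  define I where "I = {i. i < n \<and> X i = X i0}"
  define J where "J = {j. j < n \<and> X (\<pi> j) = X i0}"
  have "nonsingular_on (\<lambda>j i. \<omega> ^ (y j * m i)) J I"
  proof (rule chebotarev_nonsingular_on[OF p \<omega> inj\<omega>])
    show "card J = card I" unfolding I_def J_def by (rule card_permuted_fibre[OF \<pi>])
    show "inj_on m I" using m(1) unfolding inj_on_def I_def by auto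
    show "inj_on y J" by (rule inj_on_subset[OF y(1)]) (auto simp: J_def)
  qed (use m(2) y(2) in \<open>auto simp: I_def J_def\<close>)
  moreover have "(\<Sum>i\<in>I. \<omega> ^ (y j * m i) * v i) = 0" if "j \<in> J" for j
  proof -
    have "(\<Sum>i\<in>I. \<omega> ^ (y j * m i) * v i)
        = (\<Sum>i<n. (if X i = X (\<pi> j) then \<omega> ^ (y j * m i) else 0) * v i)"
      using that by (intro sum.mono_neutral_cong_left) (auto simp: I_def J_def)
    also have "\<dots> = 0" by (rule v(3)) (use that in \<open>simp add: J_def\<close>)
    finally show ?thesis .
  qed
  ultimately have "\<forall>i\<in>I. v i = 0" unfolding nonsingular_on_def by blast
  with v show False by (simp add: I_def)
qed

text \<open>
  The matrix of the short-time Fourier transform on \<open>\<int>/p\<close>, with rows \<open>(x, m)\<close> for the time shift \<open>x\<close> and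
  the character \<open>y \<mapsto> cnj \<omega>\<^bsup>y m\<^esup>\<close>, and columns \<open>y\<close>. The complex conjugate of the window is
  \<open>r \<mapsto> t\<^bsup>w(r)\<^esup>\<close> with \<open>w(r) = 2\<^bsup>p - r\<^esup>\<close> for \<open>0 \<le> r < p\<close>.
\<close>
definition gabor_entry :: "nat \<Rightarrow> complex \<Rightarrow> complex \<Rightarrow> int \<times> nat \<Rightarrow> int \<Rightarrow> complex" where
  "gabor_entry p \<omega> t = (\<lambda>(x, m) y. t ^ 2 ^ (p - nat ((y - x) mod int p)) * \<omega> ^ (nat y * m))"

text \<open>
  The permutations of the Leibniz expansion match the columns \<open>y\<close> with the rows \<open>(x, m)\<close>. A pair
  contributes a power of \<open>t\<close> that depends only on \<open>(y - x) mod p\<close>, and the rows with the same \<open>x\<close> form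
  the classes within which partners may be exchanged.
\<close>
lemma gabor_minor_generic:
  fixes \<omega> :: complex
  assumes p: "prime p" and \<omega>: "\<omega> ^ p = 1" and inj\<omega>: "inj_on (\<lambda>k. \<omega> ^ k) {..<p}"
    and S: "S \<subseteq> {0..<int p} \<times> {..<p}" and A: "A \<subseteq> {0..<int p}" and card: "card S = card A"
  shows "\<exists>P. P \<noteq> 0 \<and> (\<forall>t. poly P t \<noteq> 0 \<longrightarrow> nonsingular_on (gabor_entry p \<omega> t) S A)"
proof -
  let ?n = "card S"
  have p0: "p > 0" using p prime_gt_0_nat by blast
  have fin: "finite S" "finite A" using S A by (auto intro: finite_subset)
  obtain a where a: "bij_betw a {..<?n} S"
    using ex_bij_betw_nat_finite[OF fin(1)] by (auto simp: atLeast0LessThan)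
  obtain b where b: "bij_betw b {..<?n} A"
    using ex_bij_betw_nat_finite[OF fin(2)] by (auto simp: atLeast0LessThan card)
  define X where "X = fst \<circ> a"
  define m where "m = snd \<circ> a"
  define y where "y = nat \<circ> b"
  define d where "d = (\<lambda>j i. nat ((b j - X i) mod int p))"
  have aS: "X i \<in> {0..<int p}" "m i < p" if "i < ?n" for i
    using subsetD[OF S bij_betw_apply[OF a, of i]] that by (auto simp: X_def m_def mem_Times_iff)
  have bA: "b j \<in> {0..<int p}" if "j < ?n" for j
    using subsetD[OF A bij_betw_apply[OF b, of j]] that by simp
  have binj: "inj_on b {..<?n}" using b by (simp add: bij_betw_def)
  have d_eq: "d j i = d j' i' \<longleftrightarrow> int p dvd (b j - X i) - (b j' - X i')" for i j i' j'
    using p0 by (simp add: d_def nat_eq_iff mod_eq_dvd_iff[symmetric])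
  have small: "u = v" if "int p dvd u - v" "u \<in> {0..<int p}" "v \<in> {0..<int p}" for u v
    using that by (auto simp: mod_eq_dvd_iff[symmetric])
  define P where "P = det (mat ?n ?n (\<lambda>(j, i). Polynomial.monom (\<omega> ^ (y j * m i)) (2 ^ (p - d j i))))"
  have "P \<noteq> 0"
    unfolding P_def
  proof (rule det_weighted_nonzero[where X = X])
    fix j i assume "j < ?n" "i < ?n"
    show "d j i < p" using p0 by (simp add: d_def nat_less_iff)
  next
    fix i j j' assume *: "i < ?n" "j < ?n" "j' < ?n" "d j i = d j' i"
    then have "b j = b j'" using small bA d_eq by simp
    then show "j = j'" using inj_onD[OF binj] * by simp
  next
    fix j i i' assume *: "j < ?n" "i < ?n" "i' < ?n"
    show "d j i = d j i' \<longleftrightarrow> X i = X i'"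
      using small[of "X i'" "X i"] aS * by (auto simp: d_eq)
  next
    fix \<pi> assume \<pi>: "\<pi> permutes {0..<?n}"
    show "det (mat ?n ?n (\<lambda>(j, i). if X i = X (\<pi> j) then \<omega> ^ (y j * m i) else 0)) \<noteq> 0"
    proof (rule det_fourier_blocks_nonzero[OF p \<omega> inj\<omega> _ _ _ _ \<pi>])
      show "inj_on (\<lambda>i. (X i, m i)) {..<?n}" using a by (simp add: bij_betw_def X_def m_def)
      show "inj_on y {..<?n}"
        using inj_onD[OF binj] bA unfolding y_def inj_on_def by (auto simp: eq_nat_nat_iff)
    qed (use aS bA in \<open>auto simp: y_def nat_less_iff\<close>)
  qed
  moreover have "nonsingular_on (gabor_entry p \<omega> t) S A" if "poly P t \<noteq> 0" for t
  proof -
    let ?M = "mat ?n ?n (\<lambda>(i, j). gabor_entry p \<omega> t (a i) (b j))"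
    have "poly P t = det (transpose_mat ?M)"
      unfolding P_def comm_ring_hom.hom_det[OF poly_hom.comm_ring_hom_axioms, symmetric]
      by (rule arg_cong[where f = det], rule eq_matI)
         (auto simp: poly_monom gabor_entry_def d_def X_def m_def y_def split: prod.split)
    also have "\<dots> = det ?M" by (rule det_transpose[of _ ?n]) simp
    finally show ?thesis using that unfolding nonsingular_on_iff_det[OF a b] by simp
  qed
  ultimately show ?thesis by blast
qed

text \<open>Each minor is a nonzero polynomial in \<open>t\<close>, and there are finitely many minors.\<close>
lemma exists_gabor_parameter:
  fixes \<omega> :: complex
  assumes p: "prime p" and \<omega>: "\<omega> ^ p = 1" and inj\<omega>: "inj_on (\<lambda>k. \<omega> ^ k) {..<p}"
  shows "\<exists>t. t \<noteq> 0 \<and> 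
    all_minors_nonsingular (gabor_entry p \<omega> t) ({0..<int p} \<times> {..<p}) {0..<int p}"
proof -
  define I where "I = {(S, A). S \<subseteq> {0..<int p} \<times> {..<p} \<and> A \<subseteq> {0..<int p} \<and> card S = card A}"
  have "I \<subseteq> Pow ({0..<int p} \<times> {..<p}) \<times> Pow {0..<int p}" by (auto simp: I_def)
  then have fin: "finite I" by (rule finite_subset) simp
  have "\<forall>i\<in>I. \<exists>P. P \<noteq> 0 \<and> (\<forall>t. poly P t \<noteq> 0 \<longrightarrow> nonsingular_on (gabor_entry p \<omega> t) (fst i) (snd i))"
    using gabor_minor_generic[OF p \<omega> inj\<omega>] by (auto simp: I_def)
  from bchoice[OF this] obtain P where P: "\<And>i. i \<in> I \<Longrightarrow> P i \<noteq> 0"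
    "\<And>i t. i \<in> I \<Longrightarrow> poly (P i) t \<noteq> 0 \<Longrightarrow> nonsingular_on (gabor_entry p \<omega> t) (fst i) (snd i)"
    by blast
  define Q where "Q = [:0, 1:] * (\<Prod>i\<in>I. P i)"
  have "Q \<noteq> 0" using P(1) fin by (simp add: Q_def)
  then have "finite {t. poly Q t = 0}" by (rule poly_roots_finite)
  then have "{t. poly Q t = 0} \<noteq> UNIV" using infinite_UNIV_char_0 by metis
  then obtain t where "poly Q t \<noteq> 0" by auto
  then have t: "t \<noteq> 0" "\<And>i. i \<in> I \<Longrightarrow> poly (P i) t \<noteq> 0"
    using fin by (auto simp: Q_def poly_prod)
  have "nonsingular_on (gabor_entry p \<omega> t) S A"
    if "S \<subseteq> {0..<int p} \<times> {..<p}" "A \<subseteq> {0..<int p}" "card S = card A" for S A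
    using P(2)[OF _ t(2), of "(S, A)"] that by (simp add: I_def)
  with t(1) show ?thesis unfolding all_minors_nonsingular_def by blast
qed

section \<open>Supports and zeros for matrices with nonzero minors\<close>

text \<open>A homogeneous linear system with fewer equations than unknowns has a nonzero solution.\<close>
lemma underdetermined_nontrivial_kernel:
  fixes E :: "'r \<Rightarrow> 'c \<Rightarrow> complex"
  assumes fin: "finite Z" "finite A" and less: "card Z < card A"
  shows "\<exists>v. (\<exists>y\<in>A. v y \<noteq> 0) \<and> (\<forall>s\<in>Z. (\<Sum>y\<in>A. E s y * v y) = 0)"
proof -
  let ?n = "card A"
  obtain a where a: "bij_betw a {..<card Z} Z"
    using ex_bij_betw_nat_finite[OF fin(1)] by (auto simp: atLeast0LessThan)
  obtain b where b: "bij_betw b {..<?n} A"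
    using ex_bij_betw_nat_finite[OF fin(2)] by (auto simp: atLeast0LessThan)
  define F where "F = (\<lambda>i j. if i < card Z then E (a i) (b j) else 0)"
  have F: "F i j = E (a i) (b j)" if "i < card Z" for i j
    using that by (simp add: F_def)
  \<comment> \<open>The matrix \<open>F\<close> has a zero row, with index \<open>card Z\<close>, so the corresponding unit vector is in the kernel of its transpose \<open>?M\<close>.\<close>
  let ?M = "mat ?n ?n (\<lambda>(j, i). F i j)"
  have "(\<Sum>i<?n. F i j * (if i = card Z then 1 else 0)) = 0" for j
    by (rule sum.neutral) (auto simp: F_def)
  then have "det ?M = 0"
    unfolding det_mat_eq_0_iff using less by (intro exI[of _ "\<lambda>i. if i = card Z then 1 else 0"]) auto
  moreover have "det (transpose_mat ?M) = det ?M" by (rule det_transpose[of _ ?n]) simp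
  moreover have "transpose_mat ?M = mat ?n ?n (\<lambda>(i, j). F i j)" by (rule eq_matI) auto
  ultimately have "det (mat ?n ?n (\<lambda>(i, j). F i j)) = 0" by simp
  then obtain v j where v: "j < ?n" "v j \<noteq> 0" "\<And>i. i < ?n \<Longrightarrow> (\<Sum>j<?n. F i j * v j) = 0"
    unfolding det_mat_eq_0_iff by blast
  define v' where "v' = v \<circ> the_inv_into {..<?n} b"
  have v': "v' (b j) = v j" if "j < ?n" for j
    using b that by (auto simp: v'_def bij_betw_def the_inv_into_f_f)
  have "(\<Sum>y\<in>A. E s y * v' y) = 0" if "s \<in> Z" for s
  proof -
    have "s \<in> a ` {..<card Z}" using that bij_betw_imp_surj_on[OF a] by simp
    then obtain i where i: "s = a i" "i < card Z" by auto
    have "(\<Sum>y\<in>A. E s y * v' y) = (\<Sum>j<?n. E s (b j) * v' (b j))"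
      using sum.reindex_bij_betw[OF b, of "\<lambda>y. E s y * v' y"] by simp
    also have "\<dots> = (\<Sum>j<?n. F i j * v j)"
    proof (rule sum.cong[OF refl])
      fix j assume "j \<in> {..<?n}"
      then have "v' (b j) = v j" by (intro v') simp
      moreover have "F i j = E (a i) (b j)" by (rule F[OF i(2)])
      ultimately show "E s (b j) * v' (b j) = F i j * v j" using i(1) by simp
    qed
    also have "\<dots> = 0" by (rule v(3)[OF less_trans[OF i(2) less]])
    finally show ?thesis .
  qed
  moreover have "b j \<in> A" "v' (b j) \<noteq> 0"
    using bij_betw_apply[OF b, of j] v v' by auto
  ultimately show ?thesis by blast
qed

context
  fixes E :: "'r \<Rightarrow> 'c \<Rightarrow> complex" and R :: "'r set" and C :: "'c set"
  assumes finR: "finite R" and finC: "finite C"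
    and minors: "all_minors_nonsingular E R C"
begin

lemma card_zeros_less_card_support:
  assumes "y \<in> C" "v y \<noteq> 0"
  shows "card {s\<in>R. (\<Sum>y\<in>C. E s y * v y) = 0} < card {y\<in>C. v y \<noteq> 0}"
proof (rule ccontr)
  let ?Z = "{s\<in>R. (\<Sum>y\<in>C. E s y * v y) = 0}" and ?A = "{y\<in>C. v y \<noteq> 0}"
  assume "\<not> card ?Z < card ?A"
  then obtain S where S: "S \<subseteq> ?Z" "card S = card ?A"
    using obtain_subset_with_card_n[of "card ?A" ?Z] by (auto simp: not_less)
  have "S \<subseteq> R" "?A \<subseteq> C" using S(1) by auto
  with minors S(2) have "nonsingular_on E S ?A"
    unfolding all_minors_nonsingular_def by blast
  moreover have "(\<Sum>y\<in>?A. E s y * v y) = 0" if "s \<in> S" for s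
  proof -
    have "(\<Sum>y\<in>?A. E s y * v y) = (\<Sum>y\<in>C. E s y * v y)"
      using finC by (intro sum.mono_neutral_left) auto
    then show ?thesis using S that by auto
  qed
  ultimately have "\<forall>y\<in>?A. v y = 0" unfolding nonsingular_on_def by blast
  with assms show False by blast
qed

lemma uncertainty_of_nonsingular_minors:
  assumes "y \<in> C" "v y \<noteq> 0"
  shows "card R + 1 \<le> card {y\<in>C. v y \<noteq> 0} + card {s\<in>R. (\<Sum>y\<in>C. E s y * v y) \<noteq> 0}"
proof -
  let ?Z = "{s\<in>R. (\<Sum>y\<in>C. E s y * v y) = 0}" and ?N = "{s\<in>R. (\<Sum>y\<in>C. E s y * v y) \<noteq> 0}"
  have "card R = card ?Z + card ?N"
    using finR by (subst card_Un_disjoint[symmetric]) (auto intro!: arg_cong[where f = card])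
  with card_zeros_less_card_support[of y v, OF assms] show ?thesis by linarith
qed

text \<open>
  If \<open>Z\<close> is one row smaller than \<open>A\<close>, then any nonzero \<open>v\<close> supported in \<open>A\<close> whose transform vanishes on \<open>Z\<close>
  will do, because there is no room for a smaller support or for more zeros. If \<open>Z\<close> is smaller still,
  enlarge it by a row \<open>r\<close> and by a different row \<open>r'\<close>, and take a generic combination of the two
  vectors so obtained.
\<close>
lemma exists_prescribed_support_and_zeros:
  assumes CR: "card C \<le> card R" and A: "A \<subseteq> C" and Z: "Z \<subseteq> R" and less: "card Z < card A"
  shows "\<exists>v. (\<forall>y\<in>C. v y \<noteq> 0 \<longleftrightarrow> y \<in> A) \<and> (\<forall>s\<in>R. (\<Sum>y\<in>C. E s y * v y) = 0 \<longleftrightarrow> s \<in> Z)"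
  using Z less
proof (induction "card A - Suc (card Z)" arbitrary: Z)
  case 0
  then have card: "card A = Suc (card Z)" by simp
  have fin: "finite Z" "finite A" using 0(2) A finR finC by (auto intro: finite_subset)
  obtain w y where w: "y \<in> A" "w y \<noteq> 0" "\<And>s. s \<in> Z \<Longrightarrow> (\<Sum>y\<in>A. E s y * w y) = 0"
    using underdetermined_nontrivial_kernel[OF fin 0(3), of E] by blast
  define v where "v = (\<lambda>y. if y \<in> A then w y else 0)"
  let ?Z = "{s\<in>R. (\<Sum>y\<in>C. E s y * v y) = 0}" and ?A = "{y\<in>C. v y \<noteq> 0}"
  have "(\<Sum>y\<in>C. E s y * v y) = (\<Sum>y\<in>A. E s y * w y)" for s
    using finC A by (intro sum.mono_neutral_cong_right) (auto simp: v_def)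
  then have sub: "Z \<subseteq> ?Z" "?A \<subseteq> A" using w(3) 0(2) by (auto simp: v_def)
  have "card ?Z < card ?A"
    by (rule card_zeros_less_card_support[of y]) (use w A in \<open>auto simp: v_def\<close>)
  moreover have "card Z \<le> card ?Z" using sub finR by (intro card_mono) auto
  moreover have "card ?A \<le> card A" using sub fin by (intro card_mono) auto
  ultimately have "card Z = card ?Z" "card ?A = card A" using card by linarith+
  then have "Z = ?Z" "?A = A"
    using card_subset_eq[OF _ sub(1)] card_subset_eq[OF _ sub(2)] fin finR by simp_all
  then show ?case by (intro exI[of _ v]) blast
next
  case (Suc e)
  have fin: "finite Z" using Suc.prems finR by (auto intro: finite_subset)
  have "card A \<le> card C" using A finC by (rule card_mono[rotated])
  then have "2 \<le> card (R - Z)" using Suc.hyps(2) CR Suc.prems fin by (subst card_Diff_subset) auto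
  then obtain D where "D \<subseteq> R - Z" "card D = 2"
    using obtain_subset_with_card_n by metis
  then obtain r r' where r: "r \<in> R - Z" "r' \<in> R - Z" "r \<noteq> r'"
    by (auto simp: card_2_iff)
  let ?T = "\<lambda>v s. \<Sum>y\<in>C. E s y * v y"
  have "card (insert r Z) = Suc (card Z)" "card (insert r' Z) = Suc (card Z)"
    using r fin by auto
  then have IH: "\<exists>v. (\<forall>y\<in>C. v y \<noteq> 0 \<longleftrightarrow> y \<in> A) \<and> (\<forall>s\<in>R. ?T v s = 0 \<longleftrightarrow> s \<in> insert q Z)"
    if "q \<in> {r, r'}" for q
    using that Suc.hyps(2) Suc.prems r by (intro Suc.hyps(1)) auto
  obtain v1 where v1: "\<And>y. y \<in> C \<Longrightarrow> v1 y \<noteq> 0 \<longleftrightarrow> y \<in> A"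
    "\<And>s. s \<in> R \<Longrightarrow> ?T v1 s = 0 \<longleftrightarrow> s \<in> insert r Z" using IH[of r] by blast
  obtain v2 where v2: "\<And>y. y \<in> C \<Longrightarrow> v2 y \<noteq> 0 \<longleftrightarrow> y \<in> A"
    "\<And>s. s \<in> R \<Longrightarrow> ?T v2 s = 0 \<longleftrightarrow> s \<in> insert r' Z" using IH[of r'] by blast
  define bad where "bad = (\<lambda>y. - v1 y / v2 y) ` C \<union> (\<lambda>s. - ?T v1 s / ?T v2 s) ` R"
  have "finite bad" using finC finR by (simp add: bad_def)
  then obtain c where c: "c \<notin> bad" using ex_new_if_finite[OF infinite_UNIV_char_0] by blast
  have good: "a + c * b \<noteq> 0" if "b \<noteq> 0" "c \<noteq> - a / b" for a b
    using that by (auto simp: field_simps add_eq_0_iff)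
  define v where "v = (\<lambda>y. v1 y + c * v2 y)"
  have T: "?T v s = ?T v1 s + c * ?T v2 s" for s
    by (simp add: v_def sum.distrib sum_distrib_left algebra_simps)
  have "v y \<noteq> 0 \<longleftrightarrow> y \<in> A" if y: "y \<in> C" for y
  proof (cases "y \<in> A")
    case True
    then have "v y \<noteq> 0"
      unfolding v_def using c y v2(1)[OF y] by (intro good) (auto simp: bad_def)
    with True show ?thesis by simp
  next
    case False then show ?thesis using v1(1)[OF y] v2(1)[OF y] by (simp add: v_def)
  qed
  moreover have "?T v s = 0 \<longleftrightarrow> s \<in> Z" if s: "s \<in> R" for s
  proof (cases "s \<in> insert r' Z")
    case True
    then have "?T v2 s = 0" using v2(2)[OF s] by simp
    then have "?T v s = ?T v1 s" unfolding T by simp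
    then show ?thesis using True v1(2)[OF s] r by auto
  next
    case False
    then have "?T v s \<noteq> 0"
      unfolding T using c s v2(2)[OF s] by (intro good) (auto simp: bad_def)
    with False show ?thesis by simp
  qed
  ultimately show ?case by (intro exI[of _ v]) blast
qed

lemma exists_prescribed_norms:
  assumes CR: "card C \<le> card R" and k: "k \<le> card C" and l: "l \<le> card R" and kl: "card R + 1 \<le> k + l"
  shows "\<exists>v. card {y\<in>C. v y \<noteq> 0} = k \<and> card {s\<in>R. (\<Sum>y\<in>C. E s y * v y) \<noteq> 0} = l"
proof -
  obtain A where A: "A \<subseteq> C" "card A = k" using obtain_subset_with_card_n[OF k] by blast
  obtain Z where Z: "Z \<subseteq> R" "card Z = card R - l"
    using obtain_subset_with_card_n[of "card R - l" R] by auto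
  have "card Z < card A" using A Z kl l by linarith
  then obtain v where v: "\<forall>y\<in>C. v y \<noteq> 0 \<longleftrightarrow> y \<in> A"
    "\<forall>s\<in>R. (\<Sum>y\<in>C. E s y * v y) = 0 \<longleftrightarrow> s \<in> Z"
    using exists_prescribed_support_and_zeros[OF CR A(1) Z(1)] by blast
  have "{y\<in>C. v y \<noteq> 0} = A" using v(1) A by blast
  moreover have "{s\<in>R. (\<Sum>y\<in>C. E s y * v y) \<noteq> 0} = R - Z" using v(2) by blast
  moreover have "card (R - Z) = l"
    using Z l finR by (simp add: card_Diff_subset finite_subset)
  ultimately show ?thesis using A by (intro exI[of _ v]) simp
qed

end

section \<open>Characters of the cyclic group\<close>

lemma dual_integer_mod_group_iff:
  assumes p: "p > 1"
  shows "\<xi> \<in> carrier (dual_group (integer_mod_group p)) \<longleftrightarrow>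
    (\<exists>u. u ^ p = 1 \<and> \<xi> = (\<lambda>y\<in>{0..<int p}. u ^ nat y))" (is "?L \<longleftrightarrow> ?R")
proof
  have carrier: "carrier (integer_mod_group p) = {0..<int p}"
    using p by (simp add: carrier_integer_mod_group)
  {
    assume ?L
    then have \<xi>: "\<xi> \<in> extensional {0..<int p}" "\<And>y. y \<in> {0..<int p} \<Longrightarrow> cmod (\<xi> y) = 1"
      and hom: "\<And>x y. x \<in> {0..<int p} \<Longrightarrow> y \<in> {0..<int p} \<Longrightarrow> \<xi> ((x + y) mod int p) = \<xi> x * \<xi> y"
      by (auto simp: dual_group_def circle_group_def hom_def carrier Pi_iff)
    have "\<xi> 0 = \<xi> 0 * \<xi> 0" using hom[of 0 0] p by simp
    moreover have "\<xi> 0 \<noteq> 0" using \<xi>(2)[of 0] p by auto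
    ultimately have 0: "\<xi> 0 = 1" by simp
    have pow: "\<xi> (int n) = \<xi> 1 ^ n" if "n < p" for n
      using that
    proof (induction n)
      case (Suc n)
      have "(int n + 1) mod int p = int (Suc n)" using Suc.prems by simp
      with hom[of "int n" 1] have "\<xi> (int (Suc n)) = \<xi> (int n) * \<xi> 1" using Suc.prems p by simp
      with Suc show ?case by simp
    qed (simp add: 0)
    have "\<xi> 1 ^ p = \<xi> 1 ^ (p - 1) * \<xi> 1" using power_minus_mult[of p "\<xi> 1"] p by simp
    also have "\<dots> = \<xi> (int (p - 1)) * \<xi> 1" using pow[of "p - 1"] p by simp
    also have "\<dots> = \<xi> ((int (p - 1) + 1) mod int p)" using hom[of "int (p - 1)" 1] p by simp
    also have "int (p - 1) + 1 = int p" using p by simp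
    also have "\<xi> (int p mod int p) = 1" by (simp add: 0)
    finally have "\<xi> 1 ^ p = 1" .
    moreover have "\<xi> = (\<lambda>y\<in>{0..<int p}. \<xi> 1 ^ nat y)"
    proof (rule extensionalityI[OF \<xi>(1)])
      fix y assume "y \<in> {0..<int p}"
      then show "\<xi> y = (\<lambda>y\<in>{0..<int p}. \<xi> 1 ^ nat y) y" using pow[of "nat y"] by (simp add: nat_less_iff)
    qed simp
    ultimately show ?R by blast
  }
  assume ?R
  then obtain u where u: "u ^ p = 1" "\<xi> = (\<lambda>y\<in>{0..<int p}. u ^ nat y)" by blast
  have norm: "cmod u = 1" using power_eq_1_iff[OF u(1)] p by simp
  have hom: "\<xi> ((x + y) mod int p) = \<xi> x * \<xi> y"
    if "x \<in> {0..<int p}" "y \<in> {0..<int p}" for x y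
  proof -
    have "nat ((x + y) mod int p) = (nat x + nat y) mod p"
      using that by (simp add: nat_mod_distrib nat_add_distrib)
    moreover have "(x + y) mod int p \<in> {0..<int p}" using p by simp
    ultimately show ?thesis
      using that by (simp add: u(2) root_of_unity_power_mod[OF u(1)] power_add)
  qed
  have "\<xi> \<in> hom (integer_mod_group p) circle_group"
  proof (rule homI)
    fix y assume "y \<in> carrier (integer_mod_group p)"
    then show "\<xi> y \<in> carrier circle_group"
      by (simp add: u(2) carrier circle_group_def norm norm_power)
  next
    fix x y assume "x \<in> carrier (integer_mod_group p)" "y \<in> carrier (integer_mod_group p)"
    then show "\<xi> (x \<otimes>\<^bsub>integer_mod_group p\<^esub> y) = \<xi> x \<otimes>\<^bsub>circle_group\<^esub> \<xi> y"
      using hom[of x y] by (simp only: carrier mult_integer_mod_group) (simp add: circle_group_def)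
  qed
  moreover have "\<xi> \<in> extensional {0..<int p}" by (simp add: u(2))
  ultimately show ?L by (simp add: dual_group_def carrier)
qed

text \<open>
  The characters of \<open>\<int>/p\<close> are numbered by frequencies \<open>\<phi> \<xi> < p\<close>. The conjugate of a character is
  described, as this is what enters the short-time Fourier transform.
\<close>
lemma dual_integer_mod_group_frequencies:
  fixes \<omega> :: complex
  assumes p: "p > 1" and roots: "bij_betw (\<lambda>k. \<omega> ^ k) {..<p} {z. z ^ p = 1}"
  obtains \<phi> where "bij_betw \<phi> (carrier (dual_group (integer_mod_group p))) {..<p}"
    "\<And>\<xi> y. \<xi> \<in> carrier (dual_group (integer_mod_group p)) \<Longrightarrow> y \<in> {0..<int p} \<Longrightarrow>
      cnj (\<xi> y) = \<omega> ^ (nat y * \<phi> \<xi>)"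
proof -
  let ?D = "carrier (dual_group (integer_mod_group p))"
  define \<chi> where "\<chi> = (\<lambda>m. \<lambda>y\<in>{0..<int p}. cnj (\<omega> ^ m) ^ nat y)"
  have "bij_betw \<chi> {..<p} ?D"
    unfolding bij_betw_def
  proof
    show "inj_on \<chi> {..<p}"
    proof
      fix m m' assume *: "m \<in> {..<p}" "m' \<in> {..<p}" "\<chi> m = \<chi> m'"
      have "\<chi> m 1 = \<chi> m' 1" using *(3) by simp
      then have "\<omega> ^ m = \<omega> ^ m'" using p by (simp add: \<chi>_def flip: complex_cnj_power)
      then show "m = m'" using inj_onD[OF bij_betw_imp_inj_on[OF roots]] * by simp
    qed
    show "\<chi> ` {..<p} = ?D"
    proof (intro equalityI subsetI)
      fix \<xi> assume "\<xi> \<in> \<chi> ` {..<p}"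
      then obtain m where m: "m < p" "\<xi> = \<chi> m" by auto
      have "(\<omega> ^ m) ^ p = 1" using bij_betw_apply[OF roots, of m] m by simp
      then have "cnj (\<omega> ^ m) ^ p = 1" by (metis complex_cnj_one complex_cnj_power)
      then show "\<xi> \<in> ?D" unfolding dual_integer_mod_group_iff[OF p] m(2) \<chi>_def by blast
    next
      fix \<xi> assume "\<xi> \<in> ?D"
      then obtain u where u: "u ^ p = 1" "\<xi> = (\<lambda>y\<in>{0..<int p}. u ^ nat y)"
        unfolding dual_integer_mod_group_iff[OF p] by blast
      have "cnj u ^ p = 1" using u(1) by (metis complex_cnj_one complex_cnj_power)
      then have "cnj u \<in> (\<lambda>k. \<omega> ^ k) ` {..<p}" using bij_betw_imp_surj_on[OF roots] by simp
      then obtain m where m: "m < p" "cnj u = \<omega> ^ m" by auto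
      have "u = cnj (\<omega> ^ m)" unfolding m(2)[symmetric] by simp
      then have "\<xi> = \<chi> m" by (simp add: u(2) \<chi>_def)
      with m(1) show "\<xi> \<in> \<chi> ` {..<p}" by simp
    qed
  qed
  note \<chi> = this
  show ?thesis
  proof (rule that)
    show "bij_betw (the_inv_into {..<p} \<chi>) ?D {..<p}" by (rule bij_betw_the_inv_into[OF \<chi>])
    fix \<xi> y assume *: "\<xi> \<in> ?D" "y \<in> {0..<int p}"
    let ?m = "the_inv_into {..<p} \<chi> \<xi>"
    have "\<xi> = \<chi> ?m" using f_the_inv_into_f_bij_betw[OF \<chi>] *(1) by simp
    then have "\<xi> y = \<chi> ?m y" by (rule fun_cong)
    then show "cnj (\<xi> y) = \<omega> ^ (nat y * ?m)"
      using *(2) by (simp add: \<chi>_def power_mult mult.commute[of "nat y"])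
  qed
qed

section \<open>The uncertainty principle\<close>

theorem theorem4p5:
  fixes p :: nat and Zp :: "int monoid"
  assumes "prime p"
  defines "Zp \<equiv> integer_mod_group p"
  shows "\<exists>g \<in> cfun_space (carrier Zp) - {cfun_zero (carrier Zp)}.
    (\<forall>f \<in> cfun_space (carrier Zp) - {cfun_zero (carrier Zp)}.
       norm0 (carrier Zp) f
         + norm0 (carrier Zp \<times> carrier (dual_group Zp)) (stft Zp g f) \<ge> p ^ 2 + 1) \<and>
    (\<forall>k l :: nat. 1 \<le> k \<and> k \<le> p \<and> 1 \<le> l \<and> l \<le> p ^ 2 \<and> k + l \<ge> p ^ 2 + 1 \<longrightarrow>
       (\<exists>f \<in> cfun_space (carrier Zp).
          norm0 (carrier Zp) f = k \<and>
          norm0 (carrier Zp \<times> carrier (dual_group Zp)) (stft Zp g f) = l))"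
proof -
  have p: "p > 1" using assms(1) prime_gt_1_nat by blast
  define C where "C = {0..<int p}"
  have carrier: "carrier Zp = C"
    using p by (simp add: Zp_def carrier_integer_mod_group C_def)
  define D where "D = carrier (dual_group Zp)"
  define \<omega> where "\<omega> = cis (2 * pi / real p)"
  have "(\<lambda>k. cis (2 * pi * real k / real p)) = (\<lambda>k. \<omega> ^ k)"
    by (simp add: \<omega>_def DeMoivre mult_ac)
  then have roots: "bij_betw (\<lambda>k. \<omega> ^ k) {..<p} {z. z ^ p = 1}"
    using bij_betw_roots_unity[of p] p by simp
  have \<omega>: "\<omega> ^ p = 1" using bij_betw_apply[OF roots, of 1] p by simp
  obtain \<phi> where \<phi>: "bij_betw \<phi> D {..<p}"
    "\<And>\<xi> y. \<xi> \<in> D \<Longrightarrow> y \<in> C \<Longrightarrow> cnj (\<xi> y) = \<omega> ^ (nat y * \<phi> \<xi>)"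
    using dual_integer_mod_group_frequencies[OF p roots] unfolding D_def Zp_def C_def by metis
  obtain t where t: "t \<noteq> 0" "all_minors_nonsingular (gabor_entry p \<omega> t) (C \<times> {..<p}) C"
    using exists_gabor_parameter[OF assms(1) \<omega> bij_betw_imp_inj_on[OF roots]] unfolding C_def by blast
  define g where "g = (\<lambda>r\<in>C. cnj t ^ 2 ^ (p - nat r))"
  define E where "E = (\<lambda>s. gabor_entry p \<omega> t (map_prod id \<phi> s))"
  have "0 \<in> C" using p by (simp add: C_def)
  then have "g 0 \<noteq> cfun_zero C 0" using t(1) by (simp add: g_def cfun_zero_def)
  then have "g \<noteq> cfun_zero C" by metis
  then have g: "g \<in> cfun_space C - {cfun_zero C}" by (simp add: g_def cfun_space_def)
  have finC: "finite C" and cardC: "card C = p" by (simp_all add: C_def)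
  have cardD: "card D = p" using bij_betw_same_card[OF \<phi>(1)] by simp
  have "finite D" using bij_betw_finite[OF \<phi>(1)] by simp
  then have finR: "finite (C \<times> D)" using finC by simp
  have cardR: "card (C \<times> D) = p ^ 2"
    by (simp add: card_cartesian_product cardC cardD power2_eq_square)
  have stft: "stft Zp g f s = (\<Sum>y\<in>C. E s y * f y)" if "s \<in> C \<times> D" for f s
  proof -
    obtain x \<xi> where s: "s = (x, \<xi>)" "x \<in> C" "\<xi> \<in> D" using \<open>s \<in> C \<times> D\<close> by auto
    have "cnj (g (y \<otimes>\<^bsub>Zp\<^esub> inv\<^bsub>Zp\<^esub> x)) = t ^ 2 ^ (p - nat ((y - x) mod int p))" for y
    proof -
      have "y \<otimes>\<^bsub>Zp\<^esub> inv\<^bsub>Zp\<^esub> x = (y - x) mod int p"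
        using s(2) carrier unfolding Zp_def by (simp add: mod_add_right_eq)
      moreover have "(y - x) mod int p \<in> C" using p by (simp add: C_def)
      ultimately show ?thesis by (simp add: g_def)
    qed
    then show ?thesis
      using s \<phi>(2)[OF s(3)] carrier
      by (auto simp: stft_def D_def[symmetric] E_def gabor_entry_def mult_ac intro!: sum.cong)
  qed
  have "nonsingular_on E S A" if SA: "S \<subseteq> C \<times> D" "A \<subseteq> C" "card S = card A" for S A
  proof -
    let ?h = "map_prod id \<phi>"
    have "inj_on ?h S"
      by (rule inj_on_subset[OF map_prod_inj_on[OF inj_on_id bij_betw_imp_inj_on[OF \<phi>(1)]] SA(1)])
    then have "card (?h ` S) = card A" using SA(3) by (simp add: card_image)
    moreover have "?h ` S \<subseteq> C \<times> {..<p}" using SA(1) bij_betw_apply[OF \<phi>(1)] by auto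
    ultimately have "nonsingular_on (gabor_entry p \<omega> t) (?h ` S) A"
      using t(2) SA(2) unfolding all_minors_nonsingular_def by blast
    then show ?thesis unfolding nonsingular_on_def by (simp add: E_def)
  qed
  then have minors: "all_minors_nonsingular E (C \<times> D) C" unfolding all_minors_nonsingular_def by blast
  have norm_stft: "norm0 (C \<times> D) (stft Zp g f) = card {s \<in> C \<times> D. (\<Sum>y\<in>C. E s y * f y) \<noteq> 0}" for f
    unfolding norm0_def using stft by (intro arg_cong[where f = card]) auto
  have "p ^ 2 + 1 \<le> norm0 C f + norm0 (C \<times> D) (stft Zp g f)"
    if f: "f \<in> cfun_space C - {cfun_zero C}" for f
  proof -
    have "\<exists>y\<in>C. f y \<noteq> 0"
    proof (rule ccontr)
      assume "\<not> ?thesis"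
      then have "f = cfun_zero C"
        using f by (intro extensionalityI[of f C]) (auto simp: cfun_space_def cfun_zero_def PiE_def)
      with f show False by simp
    qed
    then obtain y where "y \<in> C" "f y \<noteq> 0" by blast
    with uncertainty_of_nonsingular_minors[where E = E and v = f and y = y, OF finR finC minors]
    show ?thesis unfolding norm_stft unfolding norm0_def cardR .
  qed
  moreover have "\<exists>f\<in>cfun_space C. norm0 C f = k \<and> norm0 (C \<times> D) (stft Zp g f) = l"
    if "k \<le> p" "l \<le> p ^ 2" "p ^ 2 + 1 \<le> k + l" for k l
  proof -
    have "card C \<le> card (C \<times> D)" by (simp add: cardC cardR power2_eq_square)
    moreover have "k \<le> card C" "l \<le> card (C \<times> D)" "card (C \<times> D) + 1 \<le> k + l"
      unfolding cardC cardR by fact+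
    ultimately have "\<exists>v. card {y\<in>C. v y \<noteq> 0} = k \<and> card {s\<in>C \<times> D. (\<Sum>y\<in>C. E s y * v y) \<noteq> 0} = l"
      by (rule exists_prescribed_norms[where E = E, OF finR finC minors])
    then obtain v where v: "card {y\<in>C. v y \<noteq> 0} = k" "card {s\<in>C \<times> D. (\<Sum>y\<in>C. E s y * v y) \<noteq> 0} = l"
      by (elim exE conjE)
    have "norm0 C (restrict v C) = k"
      unfolding norm0_def v(1)[symmetric] by (rule arg_cong[where f = card]) auto
    moreover have "norm0 (C \<times> D) (stft Zp g (restrict v C)) = l"
      unfolding norm_stft v(2)[symmetric] by simp
    moreover have "restrict v C \<in> cfun_space C" by (simp add: cfun_space_def)
    ultimately show ?thesis by blast
  qed
  ultimately show ?thesis using g unfolding carrier D_def[symmetric] by blast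
qed

end
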